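(* The multiple-conclusion Hilbert system $\mathsf{R}_{\mathrm{BK}}$ below is $\{p,\neg p\}$-analytic, and $\rhd_{\mathsf{R}_{\mathrm{BK}}} \;=\; \rhd_{\mathrm{BK}}$.
   Context: $L$: formulas over a countably infinite set of variables with binary $\land,\lor$ and unary $\neg$. $\mathbf A$: algebra on $\{f,u,t\}$ where each connective acts classically on $\{f,t\}$-arguments and returns $u$ if any argument is $u$. Valuations: homomorphisms into $\mathbf A$. For $\Gamma,\Delta\subseteq L$, $\Gamma\rhd_{\mathrm{BK}}\Delta$ iff there is no valuation $v$ with $v[\Gamma]\subseteq\{t\}$ and $v[\Delta]\subseteq\{f,u\}$. A Set-Set Hilbert system is a set of rule schemas $\Pi/\Sigma$ ($\Pi,\Sigma$ finite, possibly empty), with all substitution instances as rules. A derivation is a finite rooted tree with nodes labelled by sets of formulas or by $\star$: a non-leaf node labelled $\Lambda$ either has a single child labelled $\star$, provided some rule instance $\Pi/\varnothing$ has $\Pi\subseteq\Lambda$, or has children labelled $\Lambda\cup\{\psi_1\},\dots,\Lambda\cup\{\psi_m\}$ for some rule instance $\Pi/\{\psi_1,\dots,\psi_m\}$ ($m\ge1$) with $\Pi\subseteq\Lambda$. A proof of $(\Gamma,\Delta)$ is a derivation whose root is labelled by a subset of $\Gamma$ and each leaf is labelled $\star$ or by a set meeting $\Delta$; $\Gamma\rhd_{\mathsf R}\Delta$ iff such a proof exists. $\mathsf R$ is $\{p,\neg p\}$-analytic if whenever $\Gamma\rhd_{\mathsf R}\Delta$ there is a proof of $(\Gamma,\Delta)$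 whose node labels contain only formulas in $S\cup\{\neg\psi:\psi\in S\}$, $S$ being the set of subformulas of formulas in $\Gamma\cup\Delta$. $\mathsf{R}_{\mathrm{BK}}$ has rule schemas: $p,\neg p/\varnothing$; $p/\neg\neg p$; $\neg\neg p/p$; $p,q/p\land q$; $\neg p,\neg q/\neg(p\land q)$; $\neg p,q/\neg(p\land q)$; $p,\neg q/\neg(p\land q)$; $\neg(p\land q)/\neg p,p$; $\neg(p\land q)/\neg q,q$; $p\land q/p$; $p\land q/q$; $\neg p,\neg q/\neg(p\lor q)$; $\neg(p\lor q)/\neg p$; $\neg(p\lor q)/\neg q$; $p\lor q/p,\neg p$; $p\lor q/q,\neg q$; $\neg p,q/p\lor q$; $p,\neg q/p\lor q$; $p,q/p\lor q$; $p\lor q/p,q$. *)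

theory Defs
  imports Main "HOL-Library.FSet"
begin

datatype fm =
    Var nat
  | Neg fm
  | Conj fm fm
  | Disj fm fm

primrec subst :: "(nat \<Rightarrow> fm) \<Rightarrow> fm \<Rightarrow> fm" where
  "subst s (Var x) = s x"
| "subst s (Neg a) = Neg (subst s a)"
| "subst s (Conj a b) = Conj (subst s a) (subst s b)"
| "subst s (Disj a b) = Disj (subst s a) (subst s b)"

primrec subfms :: "fm \<Rightarrow> fm set" where
  "subfms (Var x) = {Var x}"
| "subfms (Neg a) = insert (Neg a) (subfms a)"
| "subfms (Conj a b) = insert (Conj a b) (subfms a \<union> subfms b)"
| "subfms (Disj a b) = insert (Disj a b) (subfms a \<union> subfms b)"

datatype tv = FF | UU | TT

fun neg3 :: "tv \<Rightarrow> tv" where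
  "neg3 UU = UU"
| "neg3 TT = FF"
| "neg3 FF = TT"

fun conj3 :: "tv \<Rightarrow> tv \<Rightarrow> tv" where
  "conj3 UU _ = UU"
| "conj3 _ UU = UU"
| "conj3 TT TT = TT"
| "conj3 TT FF = FF"
| "conj3 FF TT = FF"
| "conj3 FF FF = FF"

fun disj3 :: "tv \<Rightarrow> tv \<Rightarrow> tv" where
  "disj3 UU _ = UU"
| "disj3 _ UU = UU"
| "disj3 TT TT = TT"
| "disj3 TT FF = TT"
| "disj3 FF TT = TT"
| "disj3 FF FF = FF"

definition valuation :: "(fm \<Rightarrow> tv) \<Rightarrow> bool" where
  "valuation v \<longleftrightarrow>
     (\<forall>a. v (Neg a) = neg3 (v a)) \<and>
     (\<forall>a b. v (Conj a b) = conj3 (v a) (v b)) \<and>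
     (\<forall>a b. v (Disj a b) = disj3 (v a) (v b))"

definition bk_consequence :: "fm set \<Rightarrow> fm set \<Rightarrow> bool" where
  "bk_consequence \<Gamma> \<Delta> \<longleftrightarrow> \<not> (\<exists>v. valuation v \<and> v ` \<Gamma> \<subseteq> {TT} \<and> v ` \<Delta> \<subseteq> {FF, UU})"

type_synonym schema = "fm fset \<times> fm fset"

definition instances :: "schema set \<Rightarrow> schema set" where
  "instances R = {(subst s |`| \<Pi>, subst s |`| \<Sigma>) | s \<Pi> \<Sigma>. (\<Pi>, \<Sigma>) \<in> R}"

datatype label = Star | Fms "fm set"

datatype tree = Node (label: label) (children: "tree list")

text \<open>Nodes of a tree are represented by the subtrees rooted at them.\<close>

primrec nodes :: "tree \<Rightarrow> tree set" where
  "nodes (Node l ts) = insert (Node l ts) (\<Union> (set (map nodes ts)))"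

definition derivation :: "schema set \<Rightarrow> tree \<Rightarrow> bool" where
  "derivation R d \<longleftrightarrow>
     (\<forall>n \<in> nodes d. children n \<noteq> [] \<longrightarrow>
        (\<exists>\<Lambda>. label n = Fms \<Lambda> \<and>
           ((\<exists>\<Pi>. (\<Pi>, {||}) \<in> instances R \<and> fset \<Pi> \<subseteq> \<Lambda> \<and>
                 map label (children n) = [Star]) \<or>
            (\<exists>\<Pi> \<psi>s. \<psi>s \<noteq> [] \<and> (\<Pi>, fset_of_list \<psi>s) \<in> instances R \<and> fset \<Pi> \<subseteq> \<Lambda> \<and>
                 map label (children n) = map (\<lambda>\<psi>. Fms (\<Lambda> \<union> {\<psi>})) \<psi>s))))"

definition is_proof :: "schema set \<Rightarrow> fm set \<Rightarrow> fm set \<Rightarrow> tree \<Rightarrow> bool" where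
  "is_proof R \<Gamma> \<Delta> d \<longleftrightarrow>
     derivation R d \<and>
     (\<exists>\<Lambda>. label d = Fms \<Lambda> \<and> \<Lambda> \<subseteq> \<Gamma>) \<and>
     (\<forall>n \<in> nodes d. children n = [] \<longrightarrow>
        label n = Star \<or> (\<exists>\<Lambda>. label n = Fms \<Lambda> \<and> \<Lambda> \<inter> \<Delta> \<noteq> {}))"

definition derivable :: "schema set \<Rightarrow> fm set \<Rightarrow> fm set \<Rightarrow> bool" where
  "derivable R \<Gamma> \<Delta> \<longleftrightarrow> (\<exists>d. is_proof R \<Gamma> \<Delta> d)"

definition p_negp_analytic :: "schema set \<Rightarrow> bool" where
  "p_negp_analytic R \<longleftrightarrow>
     (\<forall>\<Gamma> \<Delta>. derivable R \<Gamma> \<Delta> \<longrightarrow>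
        (let S = (\<Union>a \<in> \<Gamma> \<union> \<Delta>. subfms a) in
         \<exists>d. is_proof R \<Gamma> \<Delta> d \<and>
             (\<forall>n \<in> nodes d. \<forall>\<Lambda>. label n = Fms \<Lambda> \<longrightarrow> \<Lambda> \<subseteq> S \<union> Neg ` S)))"

definition R_BK :: "schema set" where
  "R_BK = (let p = Var 0; q = Var 1 in
    { ({|p, Neg p|}, {||}),
      ({|p|}, {|Neg (Neg p)|}),
      ({|Neg (Neg p)|}, {|p|}),
      ({|p, q|}, {|Conj p q|}),
      ({|Neg p, Neg q|}, {|Neg (Conj p q)|}),
      ({|Neg p, q|}, {|Neg (Conj p q)|}),
      ({|p, Neg q|}, {|Neg (Conj p q)|}),
      ({|Neg (Conj p q)|}, {|Neg p, p|}),
      ({|Neg (Conj p q)|}, {|Neg q, q|}),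
      ({|Conj p q|}, {|p|}),
      ({|Conj p q|}, {|q|}),
      ({|Neg p, Neg q|}, {|Neg (Disj p q)|}),
      ({|Neg (Disj p q)|}, {|Neg p|}),
      ({|Neg (Disj p q)|}, {|Neg q|}),
      ({|Disj p q|}, {|p, Neg p|}),
      ({|Disj p q|}, {|q, Neg q|}),
      ({|Neg p, q|}, {|Disj p q|}),
      ({|p, Neg q|}, {|Disj p q|}),
      ({|p, q|}, {|Disj p q|}),
      ({|Disj p q|}, {|p, q|}) })"

end

theory Submission
  imports Defs
begin

text \<open>
  Soundness is an induction on proof trees.  For completeness, fix \<open>\<Gamma>\<close> and \<open>\<Delta>\<close>, let \<open>S\<close> be the set
  of subformulas of \<open>\<Gamma> \<union> \<Delta>\<close> and \<open>U = S \<union> \<not>S\<close>.  If no proof of \<open>(\<Gamma>, \<Delta>)\<close> stays inside \<open>U\<close>, Zorn's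
  lemma extends \<open>\<Gamma>\<close> to a maximal \<open>T \<subseteq> U\<close> with no such proof of \<open>(T, \<Delta>)\<close>; chains are harmless since a
  proof uses finitely many premises.  By maximality \<open>T\<close> is closed under all rule instances with
  conclusions in \<open>U\<close>.  Sending \<open>a \<in> S\<close> to \<open>t\<close>, \<open>f\<close> or \<open>u\<close> according to whether \<open>a \<in> T\<close>, \<open>\<not>a \<in> T\<close>
  or neither is then a partial homomorphism: the rules are a transcription of the truth tables,
  and for compounds of formulas in \<open>S\<close> they mention only formulas in \<open>U\<close>.  So \<open>(\<Gamma>, \<Delta>)\<close> has a
  countermodel.  Hence a valid pair has a proof inside \<open>U\<close>, which yields completeness and, with
  soundness, analyticity.
\<close>

section \<open>Proof search inside a set of formulas\<close>

text \<open>Proof trees with labels forgotten, so that induction runs over rule applications. An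
  empty \<open>\<Sigma>\<close> needs no subproofs and so covers the child \<open>Star\<close>. Only
  conclusions are tested against \<open>U\<close>: premises already lie in \<open>\<Lambda>\<close>,
  so a root inside \<open>U\<close> keeps all labels inside \<open>U\<close>.\<close>

inductive provable_within :: "schema set \<Rightarrow> fm set \<Rightarrow> fm set \<Rightarrow> fm set \<Rightarrow> bool"
  for R U \<Delta> where
  goal: "\<Lambda> \<inter> \<Delta> \<noteq> {} \<Longrightarrow> provable_within R U \<Delta> \<Lambda>"
| rule: "\<lbrakk>(\<Pi>, \<Sigma>) \<in> instances R; fset \<Pi> \<subseteq> \<Lambda>; fset \<Sigma> \<subseteq> U;
    \<And>\<psi>. \<psi> |\<in>| \<Sigma> \<Longrightarrow> provable_within R U \<Delta> (insert \<psi> \<Lambda>)\<rbrakk>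
    \<Longrightarrow> provable_within R U \<Delta> \<Lambda>"

lemma provable_within_mono:
  assumes "provable_within R U \<Delta> \<Lambda>" and "\<Lambda> \<subseteq> \<Lambda>'"
  shows "provable_within R U \<Delta> \<Lambda>'"
  using assms
proof (induction arbitrary: \<Lambda>')
  case (goal \<Lambda>)
  then show ?case by (intro provable_within.goal) blast
next
  case (rule \<Pi> \<Sigma> \<Lambda>)
  show ?case
  proof (rule provable_within.rule)
    show "provable_within R U \<Delta> (insert \<psi> \<Lambda>')" if "\<psi> |\<in>| \<Sigma>" for \<psi>
      using rule.IH[OF that] rule.prems by blast
  qed (use rule in auto)
qed

lemma provable_within_finite_premises:
  assumes "provable_within R U \<Delta> \<Lambda>"
  obtains F where "finite F" "F \<subseteq> \<Lambda>" "provable_within R U \<Delta> F"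
proof -
  from assms have "\<exists>F. finite F \<and> F \<subseteq> \<Lambda> \<and> provable_within R U \<Delta> F"
  proof induction
    case (goal \<Lambda>)
    then obtain a where "a \<in> \<Lambda>" "a \<in> \<Delta>" by blast
    then show ?case
      by (intro exI[of _ "{a}"]) (auto intro: provable_within.goal)
  next
    case (rule \<Pi> \<Sigma> \<Lambda>)
    then obtain F where F: "\<And>\<psi>. \<psi> |\<in>| \<Sigma> \<Longrightarrow>
        finite (F \<psi>) \<and> F \<psi> \<subseteq> insert \<psi> \<Lambda> \<and> provable_within R U \<Delta> (F \<psi>)"
      by metis
    \<comment> \<open>Each branch gets its own \<open>\<psi>\<close> from the rule, so only the rest
      of \<open>F \<psi>\<close> must come from \<open>\<Lambda>\<close>. \<open>G\<close> is finite
      because \<open>\<Sigma>\<close> is.\<close>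
    define G where "G = fset \<Pi> \<union> (\<Union>\<psi> \<in> fset \<Sigma>. F \<psi> - {\<psi>})"
    have "provable_within R U \<Delta> G"
    proof (rule provable_within.rule)
      show "provable_within R U \<Delta> (insert \<psi> G)" if "\<psi> |\<in>| \<Sigma>" for \<psi>
        using F[OF that] that by (auto simp: G_def intro: provable_within_mono)
    qed (use rule in \<open>auto simp: G_def\<close>)
    moreover have "finite G" "G \<subseteq> \<Lambda>"
      using F rule.hyps(2) by (auto simp: G_def)
    ultimately show ?case by blast
  qed
  then show ?thesis using that by blast
qed

lemma provable_within_imp_proof:
  assumes "provable_within R U \<Delta> \<Lambda>" and "\<Lambda> \<subseteq> U"
  obtains d where "label d = Fms \<Lambda>" "is_proof R \<Lambda> \<Delta> d"
    "\<And>n \<Lambda>'. n \<in> nodes d \<Longrightarrow> label n = Fms \<Lambda>' \<Longrightarrow> \<Lambda>' \<subseteq> U"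
proof -
  from assms have "\<exists>d. label d = Fms \<Lambda> \<and> is_proof R \<Lambda> \<Delta> d \<and>
      (\<forall>n \<in> nodes d. \<forall>\<Lambda>'. label n = Fms \<Lambda>' \<longrightarrow> \<Lambda>' \<subseteq> U)"
  proof induction
    case (goal \<Lambda>)
    then show ?case
      by (intro exI[of _ "Node (Fms \<Lambda>) []"]) (auto simp: is_proof_def derivation_def)
  next
    case (rule \<Pi> \<Sigma> \<Lambda>)
    show ?case
    proof (cases "\<Sigma> = {||}")
      case True
      with rule show ?thesis
        by (intro exI[of _ "Node (Fms \<Lambda>) [Node Star []]"])
          (auto simp: is_proof_def derivation_def)
    next
      case False
      \<comment> \<open>Children of a tree form a list, so the finite set \<open>\<Sigma>\<close> is
        enumerated in some order.\<close>
      obtain \<psi>s where \<psi>s: "fset_of_list \<psi>s = \<Sigma>"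
        using exists_fset_of_list by blast
      then have mem: "\<psi> |\<in>| \<Sigma>" if "\<psi> \<in> set \<psi>s" for \<psi>
        using that by (auto simp: fset_of_list_elem)
      have "\<forall>\<psi> \<in> set \<psi>s. \<exists>d. label d = Fms (insert \<psi> \<Lambda>) \<and> is_proof R (insert \<psi> \<Lambda>) \<Delta> d \<and>
          (\<forall>n \<in> nodes d. \<forall>\<Lambda>'. label n = Fms \<Lambda>' \<longrightarrow> \<Lambda>' \<subseteq> U)"
        using rule.IH rule.hyps(3) rule.prems mem by (meson insert_subset subsetD)
      then obtain D where D: "\<And>\<psi>. \<psi> \<in> set \<psi>s \<Longrightarrow>
          label (D \<psi>) = Fms (insert \<psi> \<Lambda>) \<and> is_proof R (insert \<psi> \<Lambda>) \<Delta> (D \<psi>) \<and>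
          (\<forall>n \<in> nodes (D \<psi>). \<forall>\<Lambda>'. label n = Fms \<Lambda>' \<longrightarrow> \<Lambda>' \<subseteq> U)"
        by metis
      let ?d = "Node (Fms \<Lambda>) (map D \<psi>s)"
      have ne: "\<psi>s \<noteq> []" using False \<psi>s by auto
      have lab: "map label (map D \<psi>s) = map (\<lambda>\<psi>. Fms (\<Lambda> \<union> {\<psi>})) \<psi>s"
        using D by simp
      have "derivation R ?d"
        unfolding derivation_def
      proof (intro ballI impI)
        fix n assume n: "n \<in> nodes ?d" "children n \<noteq> []"
        show "\<exists>\<Lambda>. label n = Fms \<Lambda> \<and>
           ((\<exists>\<Pi>. (\<Pi>, {||}) \<in> instances R \<and> fset \<Pi> \<subseteq> \<Lambda> \<and>
                 map label (children n) = [Star]) \<or>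
            (\<exists>\<Pi> \<psi>s. \<psi>s \<noteq> [] \<and> (\<Pi>, fset_of_list \<psi>s) \<in> instances R \<and> fset \<Pi> \<subseteq> \<Lambda> \<and>
                 map label (children n) = map (\<lambda>\<psi>. Fms (\<Lambda> \<union> {\<psi>})) \<psi>s))"
        proof (cases "n = ?d")
          case True
          with ne lab \<psi>s rule.hyps(1,2) show ?thesis
            by (intro exI[of _ \<Lambda>]) (simp only: tree.sel, blast)
        next
          case False
          with n(1) obtain \<psi> where "\<psi> \<in> set \<psi>s" "n \<in> nodes (D \<psi>)" by auto
          with D[of \<psi>] n(2) show ?thesis
            unfolding is_proof_def derivation_def by blast
        qed
      qed
      moreover have "label n = Star \<or> (\<exists>\<Lambda>. label n = Fms \<Lambda> \<and> \<Lambda> \<inter> \<Delta> \<noteq> {})"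
        if "n \<in> nodes ?d" "children n = []" for n
      proof -
        from that ne obtain \<psi> where "\<psi> \<in> set \<psi>s" "n \<in> nodes (D \<psi>)" by auto
        with D[of \<psi>] that(2) show ?thesis unfolding is_proof_def by blast
      qed
      ultimately have "is_proof R \<Lambda> \<Delta> ?d" by (auto simp: is_proof_def)
      moreover have "\<forall>n \<in> nodes ?d. \<forall>\<Lambda>'. label n = Fms \<Lambda>' \<longrightarrow> \<Lambda>' \<subseteq> U"
        using D rule.prems by auto
      ultimately show ?thesis by (intro exI[of _ ?d]) simp
    qed
  qed
  then show ?thesis using that by blast
qed

text \<open>If \<open>T\<close> missed every conclusion of an applicable rule, each extension by one
  conclusion would be provable by maximality, and the rule would then prove \<open>T\<close>. For
  empty \<open>\<Sigma>\<close> the last clause says that \<open>T\<close> cannot contain all the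
  premises.\<close>

lemma maximal_unprovable_extension:
  assumes "\<not> provable_within R U \<Delta> \<Gamma>" and "\<Gamma> \<subseteq> U"
  obtains T where "\<Gamma> \<subseteq> T" "T \<subseteq> U" "T \<inter> \<Delta> = {}"
    "\<And>\<Pi> \<Sigma>. (\<Pi>, \<Sigma>) \<in> instances R \<Longrightarrow> fset \<Pi> \<subseteq> T \<Longrightarrow> fset \<Sigma> \<subseteq> U \<Longrightarrow> fset \<Sigma> \<inter> T \<noteq> {}"
proof -
  define A where "A = {T. \<Gamma> \<subseteq> T \<and> T \<subseteq> U \<and> \<not> provable_within R U \<Delta> T}"
  have "\<exists>T\<in>A. \<forall>X\<in>A. T \<subseteq> X \<longrightarrow> X = T"
  proof (rule subset_Zorn_nonempty)
    show "A \<noteq> {}" using assms by (auto simp: A_def)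
    fix C assume C: "C \<noteq> {}" "subset.chain A C"
    then have sub: "C \<subseteq> A" by (simp add: subset_chain_def)
    have "\<not> provable_within R U \<Delta> (\<Union>C)"
    proof
      assume "provable_within R U \<Delta> (\<Union>C)"
      then obtain F where F: "finite F" "F \<subseteq> \<Union>C" "provable_within R U \<Delta> F"
        by (rule provable_within_finite_premises)
      obtain X where "X \<in> C" "F \<subseteq> X"
        using finite_subset_Union_chain[OF F(1,2) C] by blast
      with F(3) sub show False
        by (auto simp: A_def dest: provable_within_mono)
    qed
    then show "\<Union>C \<in> A" using C(1) sub by (auto simp: A_def)
  qed
  then obtain T where T: "T \<in> A" and max: "\<And>X. X \<in> A \<Longrightarrow> T \<subseteq> X \<Longrightarrow> X = T" by blast
  show thesis
  proof (rule that)
    show "\<Gamma> \<subseteq> T" "T \<subseteq> U" using T by (auto simp: A_def)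
    show "T \<inter> \<Delta> = {}" using T provable_within.goal by (fastforce simp: A_def)
    fix \<Pi> \<Sigma>
    assume r: "(\<Pi>, \<Sigma>) \<in> instances R" "fset \<Pi> \<subseteq> T" "fset \<Sigma> \<subseteq> U"
    show "fset \<Sigma> \<inter> T \<noteq> {}"
    proof
      assume disj: "fset \<Sigma> \<inter> T = {}"
      have "provable_within R U \<Delta> (insert \<psi> T)" if "\<psi> |\<in>| \<Sigma>" for \<psi>
      proof (rule ccontr)
        assume "\<not> ?thesis"
        then have "insert \<psi> T \<in> A" using T r(3) that by (auto simp: A_def)
        with max disj that show False by blast
      qed
      with r have "provable_within R U \<Delta> T" by (rule provable_within.rule)
      with T show False by (simp add: A_def)
    qed
  qed
qed

section \<open>The rules of the system\<close>

text \<open>Parameters in place of schema variables: the instances of \<open>R_BK\<close> become a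
  union over pairs of formulas, with no substitutions left.\<close>

definition bk_rules :: "fm \<Rightarrow> fm \<Rightarrow> schema set" where
  "bk_rules p q =
    { ({|p, Neg p|}, {||}),
      ({|p|}, {|Neg (Neg p)|}),
      ({|Neg (Neg p)|}, {|p|}),
      ({|p, q|}, {|Conj p q|}),
      ({|Neg p, Neg q|}, {|Neg (Conj p q)|}),
      ({|Neg p, q|}, {|Neg (Conj p q)|}),
      ({|p, Neg q|}, {|Neg (Conj p q)|}),
      ({|Neg (Conj p q)|}, {|Neg p, p|}),
      ({|Neg (Conj p q)|}, {|Neg q, q|}),
      ({|Conj p q|}, {|p|}),
      ({|Conj p q|}, {|q|}),
      ({|Neg p, Neg q|}, {|Neg (Disj p q)|}),
      ({|Neg (Disj p q)|}, {|Neg p|}),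
      ({|Neg (Disj p q)|}, {|Neg q|}),
      ({|Disj p q|}, {|p, Neg p|}),
      ({|Disj p q|}, {|q, Neg q|}),
      ({|Neg p, q|}, {|Disj p q|}),
      ({|p, Neg q|}, {|Disj p q|}),
      ({|p, q|}, {|Disj p q|}),
      ({|Disj p q|}, {|p, q|}) }"

lemma instances_R_BK: "instances R_BK = (\<Union>a b. bk_rules a b)"
proof -
  have R: "R_BK = bk_rules (Var 0) (Var 1)"
    by (simp add: R_BK_def bk_rules_def Let_def)
  have img: "map_prod (fimage (subst s)) (fimage (subst s)) ` R_BK = bk_rules (s 0) (s 1)" for s
    by (simp add: R bk_rules_def)
  have "instances R_BK = (\<Union>s. map_prod (fimage (subst s)) (fimage (subst s)) ` R_BK)"
    by (force simp: instances_def)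
  also have "\<dots> = (\<Union>s :: nat \<Rightarrow> fm. bk_rules (s 0) (s 1))" by (simp only: img)
  also have "\<dots> = (\<Union>a b. bk_rules a b)"
  proof -
    have "bk_rules a b \<subseteq> (\<Union>s :: nat \<Rightarrow> fm. bk_rules (s 0) (s 1))" for a b
      \<comment> \<open>The schemas mention only variables 0 and 1, so this substitution realises
        the pair \<open>a\<close>, \<open>b\<close>.\<close>
      by (rule order_trans[OF _ UN_upper[of "\<lambda>n. if n = 0 then a else b"]]) auto
    then show ?thesis by blast
  qed
  finally show ?thesis .
qed

section \<open>Soundness\<close>

text \<open>A check of the truth tables over the nine pairs of values of \<open>a\<close> and
  \<open>b\<close>. For empty \<open>\<Sigma>\<close> it says that the premises cannot all be
  true.\<close>

lemma R_BK_instance_sound: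
  assumes "valuation v" and "(\<Pi>, \<Sigma>) \<in> instances R_BK" and "\<And>a. a |\<in>| \<Pi> \<Longrightarrow> v a = TT"
  shows "\<exists>\<psi>. \<psi> |\<in>| \<Sigma> \<and> v \<psi> = TT"
proof -
  have "\<forall>(\<Pi>, \<Sigma>) \<in> bk_rules a b.
      (\<forall>x \<in> fset \<Pi>. v x = TT) \<longrightarrow> (\<exists>\<psi> \<in> fset \<Sigma>. v \<psi> = TT)" for a b
    using assms(1)
    by (cases "v a"; cases "v b"; simp add: bk_rules_def valuation_def)
  moreover obtain a b where "(\<Pi>, \<Sigma>) \<in> bk_rules a b"
    using assms(2) by (auto simp: instances_R_BK)
  ultimately show ?thesis using assms(3) by blast
qed

text \<open>Follow a branch of true formulas: soundness of the rule used at a node supplies a child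
  whose new formula is true, and rules leading to \<open>Star\<close> never apply. The leaf reached
  meets \<open>\<Delta>\<close>.\<close>

lemma R_BK_proof_sound:
  assumes "valuation v" and "derivation R_BK d" and "label d = Fms \<Lambda>" and "v ` \<Lambda> \<subseteq> {TT}"
    and "\<And>n. n \<in> nodes d \<Longrightarrow> children n = [] \<Longrightarrow>
      label n = Star \<or> (\<exists>\<Lambda>. label n = Fms \<Lambda> \<and> \<Lambda> \<inter> \<Delta> \<noteq> {})"
  shows "\<exists>a \<in> \<Delta>. v a = TT"
  using assms(2-)
proof (induction d arbitrary: \<Lambda>)
  case (Node l ts)
  show ?case
  proof (cases "ts = []")
    case True
    with Node.prems(4)[of "Node l ts"] Node.prems(2,3) show ?thesis by auto
  next
    case False
    have step: "(\<exists>\<Pi>. (\<Pi>, {||}) \<in> instances R_BK \<and> fset \<Pi> \<subseteq> \<Lambda>) \<or>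
        (\<exists>\<Pi> \<psi>s. \<psi>s \<noteq> [] \<and> (\<Pi>, fset_of_list \<psi>s) \<in> instances R_BK \<and> fset \<Pi> \<subseteq> \<Lambda> \<and>
          map label ts = map (\<lambda>\<psi>. Fms (\<Lambda> \<union> {\<psi>})) \<psi>s)"
      using Node.prems(1,2) False unfolding derivation_def by auto
    have true: "v a = TT" if "fset \<Pi> \<subseteq> \<Lambda>" "a |\<in>| \<Pi>" for \<Pi> a
      using that Node.prems(3) by blast
    from step show ?thesis
    proof (elim disjE exE conjE)
      fix \<Pi> assume "(\<Pi>, {||}) \<in> instances R_BK" "fset \<Pi> \<subseteq> \<Lambda>"
      with R_BK_instance_sound[OF assms(1)] true show ?thesis by blast
    next
      fix \<Pi> \<psi>s
      assume r: "(\<Pi>, fset_of_list \<psi>s) \<in> instances R_BK" "fset \<Pi> \<subseteq> \<Lambda>"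
        and lab: "map label ts = map (\<lambda>\<psi>. Fms (\<Lambda> \<union> {\<psi>})) \<psi>s"
      obtain \<psi> where \<psi>: "\<psi> \<in> set \<psi>s" "v \<psi> = TT"
        using R_BK_instance_sound[OF assms(1) r(1)] true r(2)
        by (auto simp: fset_of_list_elem)
      have "Fms (\<Lambda> \<union> {\<psi>}) \<in> set (map label ts)" using \<psi>(1) lab by auto
      then obtain t where t: "t \<in> set ts" "label t = Fms (\<Lambda> \<union> {\<psi>})" by auto
      show ?thesis
      proof (rule Node.IH[OF t(1) _ t(2)])
        show "derivation R_BK t" using Node.prems(1) t(1) unfolding derivation_def by auto
        show "v ` (\<Lambda> \<union> {\<psi>}) \<subseteq> {TT}" using Node.prems(3) \<psi>(2) by auto
      qed (use Node.prems(4) t(1) in auto)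
    qed
  qed
qed

lemma derivable_R_BK_sound:
  assumes "derivable R_BK \<Gamma> \<Delta>"
  shows "bk_consequence \<Gamma> \<Delta>"
proof -
  obtain d \<Lambda> where d: "is_proof R_BK \<Gamma> \<Delta> d" "label d = Fms \<Lambda>" "\<Lambda> \<subseteq> \<Gamma>"
    using assms unfolding derivable_def is_proof_def by blast
  have "\<exists>a \<in> \<Delta>. v a = TT" if "valuation v" "v ` \<Gamma> \<subseteq> {TT}" for v
    by (rule R_BK_proof_sound[OF that(1) _ d(2)]) (use d that(2) in \<open>auto simp: is_proof_def\<close>)
  then show ?thesis unfolding bk_consequence_def by fastforce
qed

section \<open>Countermodels and completeness\<close>

primrec extend_val :: "(nat \<Rightarrow> tv) \<Rightarrow> fm \<Rightarrow> tv" where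
  "extend_val w (Var x) = w x"
| "extend_val w (Neg a) = neg3 (extend_val w a)"
| "extend_val w (Conj a b) = conj3 (extend_val w a) (extend_val w b)"
| "extend_val w (Disj a b) = disj3 (extend_val w a) (extend_val w b)"

lemma valuation_extend_val: "valuation (extend_val w)"
  by (simp add: valuation_def)

lemma subfms_refl: "a \<in> subfms a"
  by (cases a) auto

lemma subfms_trans: "a \<in> subfms b \<Longrightarrow> b \<in> subfms c \<Longrightarrow> a \<in> subfms c"
  by (induction c) auto

definition theory_value :: "fm set \<Rightarrow> fm \<Rightarrow> tv" where
  "theory_value T a = (if a \<in> T then TT else if Neg a \<in> T then FF else UU)"

text \<open>Each rule needed for a compound in \<open>S\<close> concludes with that compound, an
  immediate subformula, or a negation of one of these, so saturation within \<open>S\<close> and its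
  negations suffices.\<close>

lemma extend_val_theory_value:
  assumes closed: "\<And>a. a \<in> S \<Longrightarrow> subfms a \<subseteq> S"
    and sat: "\<And>\<Pi> \<Sigma>. (\<Pi>, \<Sigma>) \<in> instances R_BK \<Longrightarrow> fset \<Pi> \<subseteq> T \<Longrightarrow>
      fset \<Sigma> \<subseteq> S \<union> Neg ` S \<Longrightarrow> fset \<Sigma> \<inter> T \<noteq> {}"
    and "a \<in> S"
  shows "extend_val (\<lambda>x. theory_value T (Var x)) a = theory_value T a"
  using \<open>a \<in> S\<close>
proof (induction a)
  case (Var x)
  then show ?case by simp
next
  \<comment> \<open>Stated elementwise, so that unfolding \<open>bk_rules\<close> turns saturation
    into propositional clauses about membership in \<open>T\<close>.\<close>
  have rules: "\<forall>(\<Pi>, \<Sigma>) \<in> bk_rules a b. (\<forall>\<phi> \<in> fset \<Pi>. \<phi> \<in> T) \<longrightarrow>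
      (\<forall>\<psi> \<in> fset \<Sigma>. \<psi> \<in> S \<or> (\<exists>c \<in> S. \<psi> = Neg c)) \<longrightarrow> (\<exists>\<psi> \<in> fset \<Sigma>. \<psi> \<in> T)" for a b
  proof (clarify, goal_cases)
    case (1 \<Pi> \<Sigma>)
    then have "(\<Pi>, \<Sigma>) \<in> instances R_BK" "fset \<Pi> \<subseteq> T" "fset \<Sigma> \<subseteq> S \<union> Neg ` S"
      by (auto simp: instances_R_BK)
    then have "fset \<Sigma> \<inter> T \<noteq> {}" by (rule sat)
    then show ?case by blast
  qed
  \<comment> \<open>The rule \<open>p, Neg p\<close> has no conclusion to be kept inside
    \<open>S\<close>, so this holds for every \<open>c\<close>.\<close>
  have consistent: "c \<notin> T \<or> Neg c \<notin> T" for c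
    using bspec[OF rules, of "({|c, Neg c|}, {||})" c c] by (simp add: bk_rules_def)
  {
    case (Neg a)
    have S: "a \<in> S" using closed[OF Neg.prems] subfms_refl[of a] by auto
    have "Neg (Neg a) \<in> T \<longleftrightarrow> a \<in> T"
      using rules[of a a, unfolded bk_rules_def, simplified, simplified S Neg.prems, simplified]
      by argo
    with consistent[of a] have "theory_value T (Neg a) = neg3 (theory_value T a)"
      by (auto simp: theory_value_def)
    with Neg.IH S show ?case by simp
  next
    case (Conj a b)
    have S: "a \<in> S" "b \<in> S"
      using closed[OF Conj.prems] subfms_refl[of a] subfms_refl[of b] by auto
    \<comment> \<open>From \<open>Neg (Conj a b)\<close> the two splitting rules decide both
      \<open>a\<close> and \<open>b\<close>; having both in \<open>T\<close> would put
      \<open>Conj a b\<close> there too, against consistency.\<close>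
    have "Conj a b \<in> T \<longleftrightarrow> a \<in> T \<and> b \<in> T"
      "Neg (Conj a b) \<in> T \<longleftrightarrow>
        a \<in> T \<and> Neg b \<in> T \<or> Neg a \<in> T \<and> b \<in> T \<or> Neg a \<in> T \<and> Neg b \<in> T"
      using rules[of a b, unfolded bk_rules_def, simplified, simplified S Conj.prems, simplified]
        consistent[of a] consistent[of b] consistent[of "Conj a b"]
      by argo+
    with consistent[of a] consistent[of b]
    have "theory_value T (Conj a b) = conj3 (theory_value T a) (theory_value T b)"
      by (auto simp: theory_value_def)
    with Conj.IH S show ?case by simp
  next
    case (Disj a b)
    have S: "a \<in> S" "b \<in> S"
      using closed[OF Disj.prems] subfms_refl[of a] subfms_refl[of b] by auto
    \<comment> \<open>From \<open>Disj a b\<close> the splitting rules decide \<open>a\<close> and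
      \<open>b\<close>, and the rule concluding \<open>p, q\<close> with consistency excludes that
      both are refuted.\<close>
    have "Neg (Disj a b) \<in> T \<longleftrightarrow> Neg a \<in> T \<and> Neg b \<in> T"
      "Disj a b \<in> T \<longleftrightarrow>
        a \<in> T \<and> Neg b \<in> T \<or> Neg a \<in> T \<and> b \<in> T \<or> a \<in> T \<and> b \<in> T"
      using rules[of a b, unfolded bk_rules_def, simplified, simplified S Disj.prems, simplified]
        consistent[of a] consistent[of b] consistent[of "Disj a b"]
      by argo+
    with consistent[of a] consistent[of b]
    have "theory_value T (Disj a b) = disj3 (theory_value T a) (theory_value T b)"
      by (auto simp: theory_value_def)
    with Disj.IH S show ?case by simp
  }
qed

lemma R_BK_analytic_completeness:
  assumes "bk_consequence \<Gamma> \<Delta>"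
  defines "S \<equiv> \<Union>a \<in> \<Gamma> \<union> \<Delta>. subfms a"
  shows "\<exists>d. is_proof R_BK \<Gamma> \<Delta> d \<and>
    (\<forall>n \<in> nodes d. \<forall>\<Lambda>. label n = Fms \<Lambda> \<longrightarrow> \<Lambda> \<subseteq> S \<union> Neg ` S)"
proof -
  define U where "U = S \<union> Neg ` S"
  have S: "\<Gamma> \<subseteq> S" "\<Delta> \<subseteq> S" using subfms_refl by (auto simp: S_def)
  have closed: "subfms a \<subseteq> S" if "a \<in> S" for a
    using that subfms_trans by (fastforce simp: S_def)
  have "provable_within R_BK U \<Delta> \<Gamma>"
  proof (rule ccontr)
    assume "\<not> ?thesis"
    moreover have "\<Gamma> \<subseteq> U" using S by (auto simp: U_def)
    ultimately obtain T where T: "\<Gamma> \<subseteq> T" "T \<inter> \<Delta> = {}"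
      and sat: "\<And>\<Pi> \<Sigma>. (\<Pi>, \<Sigma>) \<in> instances R_BK \<Longrightarrow> fset \<Pi> \<subseteq> T \<Longrightarrow> fset \<Sigma> \<subseteq> U \<Longrightarrow>
        fset \<Sigma> \<inter> T \<noteq> {}"
      by (rule maximal_unprovable_extension) blast
    \<comment> \<open>Saturation controls \<open>theory_value T\<close> only on \<open>S\<close>, so
      the countermodel is the homomorphism with the same values on variables.\<close>
    let ?v = "extend_val (\<lambda>x. theory_value T (Var x))"
    have v: "?v a = theory_value T a" if "a \<in> S" for a
      using closed sat that unfolding U_def by (rule extend_val_theory_value)
    have "theory_value T ` \<Gamma> \<subseteq> {TT}" "theory_value T ` \<Delta> \<subseteq> {FF, UU}"
      using T by (auto simp: theory_value_def)
    then have "?v ` \<Gamma> \<subseteq> {TT}" "?v ` \<Delta> \<subseteq> {FF, UU}"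
      using v S by (auto simp: subset_iff image_iff)
    then show False
      using assms(1) valuation_extend_val unfolding bk_consequence_def by blast
  qed
  moreover have "\<Gamma> \<subseteq> U" using S by (auto simp: U_def)
  ultimately show ?thesis
    unfolding U_def by (rule provable_within_imp_proof) blast
qed

theorem theorem7:
  shows "p_negp_analytic R_BK \<and> derivable R_BK = bk_consequence"
proof
  show "p_negp_analytic R_BK"
    unfolding p_negp_analytic_def Let_def
    by (intro allI impI R_BK_analytic_completeness derivable_R_BK_sound)
  show "derivable R_BK = bk_consequence"
  proof (intro ext iffI)
    fix \<Gamma> \<Delta>
    show "bk_consequence \<Gamma> \<Delta>" if "derivable R_BK \<Gamma> \<Delta>"
      using that by (rule derivable_R_BK_sound)
    show "derivable R_BK \<Gamma> \<Delta>" if "bk_consequence \<Gamma> \<Delta>"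
      using R_BK_analytic_completeness[OF that] unfolding derivable_def by blast
  qed
qed

end
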